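(* Let $B_1,\dots,B_n\in\mathbb{C}^{p\times m}$, let $F_o(z)=z^{-1}B_1+\cdots+z^{-n}B_n$, and let $\mathbf{H}_0$ be the corresponding $np\times nm$ Hankel matrix, whose $(i,j)$ block ($1\le i,j\le n$) is $B_{i+j-1}$ if $i+j-1\le n$ and $0_{p\times m}$ otherwise. Assume that $F_o(z)$ is in $\mathcal{U}$. I. If $p\ge m$, then $$I_{mn}-\mathbf{H}_0^*\mathbf{H}_0=\begin{pmatrix}0_{m\times m}&0\\0&\Delta_{mn-m}\end{pmatrix},$$ where $\Delta_{mn-m}$ is an $(mn-m)\times(mn-m)$ positive semi-definite weak contraction. Moreover, if $p=m$ then $\Delta_{mn-m}$ is an orthogonal projection. II. If $m\ge p$, then $$I_{pn}-\mathbf{H}_0\mathbf{H}_0^*=\begin{pmatrix}0_{p\times p}&0\\0&\Delta_{pn-p}\end{pmatrix},$$ where $\Delta_{pn-p}$ is a $(pn-p)\times(pn-p)$ positive semi-definite weak contraction. Moreover, if $p=m$ then $\Delta_{pn-p}$ is an orthogonal projection.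
   Context: With $\mathbb{T}=\{z\in\mathbb{C}:|z|=1\}$, the class $\mathcal{U}$ consists of the $p\times m$-valued rational functions with $F(z)^*F(z)=I_m$ for all $z\in\mathbb{T}$ if $p\ge m$ (isometry), and $F(z)F(z)^*=I_p$ for all $z\in\mathbb{T}$ if $m\ge p$ (co-isometry). A positive semi-definite weak contraction is a Hermitian matrix $\Delta$ with $0\le\Delta\le I$. An orthogonal projection is a matrix $P$ with $P=P^*=P^2$. *)

theory Defs
  imports Complex_Main "HOL-Computational_Algebra.Polynomial"
    "Jordan_Normal_Form.Matrix" "Jordan_Normal_Form.Schur_Decomposition"
begin

definition unit_circle :: "complex set" where
  "unit_circle = {z. cmod z = 1}"

(* A p x m rational function without poles in S.  It is modelled by a total function, whose
   values at the zeros of the denominators (in particular at the poles) are irrelevant. *)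
definition rational_mat_fun_on ::
    "complex set \<Rightarrow> nat \<Rightarrow> nat \<Rightarrow> (complex \<Rightarrow> complex mat) \<Rightarrow> bool" where
  "rational_mat_fun_on S p m F \<longleftrightarrow>
     (\<forall>z. F z \<in> carrier_mat p m) \<and>
     (\<forall>i<p. \<forall>j<m. \<exists>a b :: complex poly.
        b \<noteq> 0 \<and> (\<forall>z\<in>S. poly b z \<noteq> 0) \<and>
        (\<forall>z. poly b z \<noteq> 0 \<longrightarrow> F z $$ (i, j) = poly a z / poly b z))"

(* Requiring absence of poles on the circle is part of requiring the identities at every point
   of the circle. *)
definition class_U :: "nat \<Rightarrow> nat \<Rightarrow> (complex \<Rightarrow> complex mat) \<Rightarrow> bool" where
  "class_U p m F \<longleftrightarrow>
     rational_mat_fun_on unit_circle p m F \<and>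
     (m \<le> p \<longrightarrow> (\<forall>z\<in>unit_circle. mat_adjoint (F z) * F z = 1\<^sub>m m)) \<and>
     (p \<le> m \<longrightarrow> (\<forall>z\<in>unit_circle. F z * mat_adjoint (F z) = 1\<^sub>m p))"

definition F_o :: "nat \<Rightarrow> nat \<Rightarrow> nat \<Rightarrow> (nat \<Rightarrow> complex mat) \<Rightarrow> complex \<Rightarrow> complex mat" where
  "F_o p m n B z = mat p m (\<lambda>(i, j). \<Sum>k = 1..n. inverse z ^ k * B k $$ (i, j))"

(* Rows and columns are 0-based: entry (r, c) lies in the block with 1-based index
   (i, j) = (r div p + 1, c div m + 1), so that i + j - 1 = r div p + c div m + 1. *)
definition hankel_H0 :: "nat \<Rightarrow> nat \<Rightarrow> nat \<Rightarrow> (nat \<Rightarrow> complex mat) \<Rightarrow> complex mat" where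
  "hankel_H0 p m n B = mat (n * p) (n * m) (\<lambda>(r, c).
     let k = r div p + c div m + 1
     in if k \<le> n then B k $$ (r mod p, c mod m) else 0)"

definition hermitian_mat :: "complex mat \<Rightarrow> bool" where
  "hermitian_mat A \<longleftrightarrow> square_mat A \<and> mat_adjoint A = A"

definition psd_mat :: "complex mat \<Rightarrow> bool" where
  "psd_mat A \<longleftrightarrow> hermitian_mat A \<and>
     (\<forall>v \<in> carrier_vec (dim_row A). 0 \<le> Re ((A *\<^sub>v v) \<bullet>c v))"

definition psd_weak_contraction :: "complex mat \<Rightarrow> bool" where
  "psd_weak_contraction D \<longleftrightarrow> psd_mat D \<and> psd_mat (1\<^sub>m (dim_row D) - D)"

definition orthogonal_projection :: "complex mat \<Rightarrow> bool" where
  "orthogonal_projection P \<longleftrightarrow> square_mat P \<and> P = mat_adjoint P \<and> P = P * P"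

lemma rational_mat_fun_on_F_o: "rational_mat_fun_on unit_circle p m (F_o p m n B)"
  unfolding rational_mat_fun_on_def
proof (intro conjI allI impI)
  show "F_o p m n B z \<in> carrier_mat p m" for z
    by (simp add: F_o_def)
next
  fix i j assume ij: "i < p" "j < m"
  define a :: "complex poly" where "a = (\<Sum>k = 1..n. monom (B k $$ (i, j)) (n - k))"
  define b :: "complex poly" where "b = monom 1 n"
  have "F_o p m n B z $$ (i, j) = poly a z / poly b z" if "poly b z \<noteq> 0" for z
  proof -
    have "inverse z ^ k * B k $$ (i, j) = (B k $$ (i, j) * z ^ (n - k)) / z ^ n"
      if k: "k \<in> {1..n}" for k
    proof -
      from k \<open>poly b z \<noteq> 0\<close> have z: "z \<noteq> 0"
        by (auto simp: b_def poly_monom)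
      have "z ^ n = z ^ (n - k) * z ^ k"
        using k by (simp flip: power_add)
      with z show ?thesis by (simp add: field_simps)
    qed
    then show ?thesis using ij
      by (simp add: F_o_def a_def b_def poly_sum poly_monom sum_divide_distrib)
  qed
  moreover have "b \<noteq> 0" by (simp add: b_def)
  moreover have "\<forall>z\<in>unit_circle. poly b z \<noteq> 0"
    by (auto simp: b_def poly_monom unit_circle_def)
  ultimately show "\<exists>a b :: complex poly. b \<noteq> 0 \<and> (\<forall>z\<in>unit_circle. poly b z \<noteq> 0) \<and>
      (\<forall>z. poly b z \<noteq> 0 \<longrightarrow> F_o p m n B z $$ (i, j) = poly a z / poly b z)"
    by blast
qed

end

theory Submission
  imports Defs
begin

text \<open>
  Suppose \<open>m \<le> p\<close>. Comparing coefficients in \<open>F\<^sub>o(z)\<^sup>* F\<^sub>o(z) = I\<close> on the unit circle gives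
  \<open>\<Sum>\<^sub>l B\<^sub>l\<^sub>+\<^sub>d\<^sup>* B\<^sub>l = \<delta>\<^sub>d\<^sub>0 I\<close> for \<open>d \<ge> 0\<close>, where \<open>B\<^sub>k = 0\<close> unless \<open>1 \<le> k \<le> n\<close>
  (\<open>isometry_coeffs\<close>). In other words, the block columns of the infinite block matrix
  \<open>(B\<^sub>i\<^sub>+\<^sub>j\<^sub>-\<^sub>1)\<close>, with \<open>i\<close> running through all integers and \<open>1 \<le> j \<le> n\<close>, are orthonormal. Up to zero
  rows, its rows with \<open>i \<ge> 1\<close> form \<open>H\<^sub>0\<close>, and its rows with \<open>i \<le> 0\<close>, read upwards, form the block
  Toeplitz matrix \<open>K = (B\<^sub>j\<^sub>-\<^sub>i)\<close>, \<open>1 \<le> i, j \<le> n\<close>. Hence \<open>I - H\<^sub>0\<^sup>* H\<^sub>0 = K\<^sup>* K\<close>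
  (\<open>hankel_defect_entry\<close>). The first block column of \<open>K\<close> is zero, which yields the asserted block
  form. Let \<open>K'\<close> and \<open>H'\<close> arise from \<open>K\<close> and \<open>H\<^sub>0\<close> by deleting the first block column. Then
  \<open>\<Delta> = K'\<^sup>* K'\<close> and \<open>I - \<Delta> = H'\<^sup>* H'\<close> are both Gram matrices, so \<open>0 \<le> \<Delta> \<le> I\<close>.

  If \<open>p = m\<close>, then also \<open>F\<^sub>o F\<^sub>o\<^sup>* = I\<close>. The blocks of \<open>K' H'\<^sup>*\<close> are
  \<open>\<Sum>\<^sub>l B\<^sub>l B\<^sub>l\<^sub>+\<^sub>d\<^sup>*\<close> with \<open>d > 0\<close>, so they vanish; therefore
  \<open>\<Delta> (I - \<Delta>) = K'\<^sup>* (K' H'\<^sup>*) H' = 0\<close>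
  (\<open>upper_rows_hankel_tail_orthogonal\<close>).

  The case \<open>p \<le> m\<close> is the case \<open>m \<le> p\<close> for the adjoint coefficients \<open>B\<^sub>k\<^sup>*\<close>: passing to them replaces
  \<open>H\<^sub>0\<close> by \<open>H\<^sub>0\<^sup>*\<close> and \<open>F\<^sub>o(z)\<close> by \<open>F\<^sub>o(cnj z)\<^sup>*\<close>.
\<close>

section \<open>Adjoints and Gram matrices\<close>

lemma dim_mat_adjoint [simp]:
  "dim_row (mat_adjoint A) = dim_col A" "dim_col (mat_adjoint A) = dim_row A"
  by (simp_all add: mat_adjoint_def)

lemma mat_adjoint_carrier [simp]:
  "A \<in> carrier_mat a b \<Longrightarrow> mat_adjoint A \<in> carrier_mat b a"
  by (metis carrier_matD carrier_matI dim_mat_adjoint)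

lemma index_mat_adjoint [simp]:
  fixes A :: "complex mat"
  shows "i < dim_col A \<Longrightarrow> j < dim_row A \<Longrightarrow> mat_adjoint A $$ (i, j) = cnj (A $$ (j, i))"
  by (simp add: mat_adjoint_def mat_of_rows_def)

lemma mat_adjoint_adjoint [simp]: "mat_adjoint (mat_adjoint (A :: complex mat)) = A"
  by (rule eq_matI) auto

lemma index_adjoint_mult:
  fixes A C :: "complex mat"
  assumes "A \<in> carrier_mat a b" "C \<in> carrier_mat a c" "i < b" "j < c"
  shows "(mat_adjoint A * C) $$ (i, j) = (\<Sum>k<a. cnj (A $$ (k, i)) * C $$ (k, j))"
  using assms by (auto simp: scalar_prod_def lessThan_atLeast0 intro!: sum.cong)

lemma index_mult_adjoint:
  fixes A C :: "complex mat"
  assumes "A \<in> carrier_mat a b" "C \<in> carrier_mat c b" "i < a" "j < c"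
  shows "(A * mat_adjoint C) $$ (i, j) = (\<Sum>k<b. A $$ (i, k) * cnj (C $$ (j, k)))"
  using assms by (auto simp: scalar_prod_def lessThan_atLeast0 intro!: sum.cong)

lemma hermitian_gram: "hermitian_mat (mat_adjoint A * A)"
proof -
  obtain a b where A: "A \<in> carrier_mat a b" by blast
  have "mat_adjoint (mat_adjoint A * A) = mat_adjoint A * A"
    using A by (intro eq_matI) (auto simp: index_adjoint_mult[OF A A] mult.commute
        simp del: index_mult_mat(1))
  then show ?thesis
    by (simp add: hermitian_mat_def)
qed

lemma mult_mat_vec_cscalar_adjoint:
  fixes A :: "complex mat"
  assumes A: "A \<in> carrier_mat a b" and u: "u \<in> carrier_vec a" and v: "v \<in> carrier_vec b"
  shows "(mat_adjoint A *\<^sub>v u) \<bullet>c v = u \<bullet>c (A *\<^sub>v v)"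
proof -
  have "(mat_adjoint A *\<^sub>v u) \<bullet>c v = (\<Sum>i<b. \<Sum>k<a. cnj (A $$ (k, i)) * u $ k * cnj (v $ i))"
    using assms by (auto simp: scalar_prod_def lessThan_atLeast0 sum_distrib_right intro!: sum.cong)
  also have "\<dots> = (\<Sum>k<a. \<Sum>i<b. cnj (A $$ (k, i)) * u $ k * cnj (v $ i))"
    by (rule sum.swap)
  also have "\<dots> = u \<bullet>c (A *\<^sub>v v)"
    using assms by (auto simp: scalar_prod_def lessThan_atLeast0 sum_distrib_left mult_ac intro!: sum.cong)
  finally show ?thesis .
qed

lemma psd_gram: "psd_mat (mat_adjoint A * A)"
  unfolding psd_mat_def
proof (intro conjI ballI hermitian_gram)
  fix v :: "complex vec" assume v: "v \<in> carrier_vec (dim_row (mat_adjoint A * A))"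
  obtain a b where A: "A \<in> carrier_mat a b" by blast
  from v A have v: "v \<in> carrier_vec b" by simp
  have "(mat_adjoint A * A *\<^sub>v v) \<bullet>c v = (A *\<^sub>v v) \<bullet>c (A *\<^sub>v v)"
    using A v by (subst assoc_mult_mat_vec[of _ b a]) (auto simp: mult_mat_vec_cscalar_adjoint)
  also have "\<dots> = complex_of_real (\<Sum>i<a. (cmod ((A *\<^sub>v v) $ i))\<^sup>2)"
    using A by (simp add: scalar_prod_def lessThan_atLeast0 complex_norm_square del: index_mult_mat_vec of_real_power)
  finally show "0 \<le> Re ((mat_adjoint A * A *\<^sub>v v) \<bullet>c v)"
    by (simp add: sum_nonneg)
qed

lemma sum_blocks:
  fixes g :: "nat \<Rightarrow> nat \<Rightarrow> 'a :: comm_monoid_add"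
  shows "(\<Sum>t < n * p. g (t div p) (t mod p)) = (\<Sum>k<n. \<Sum>r<p. g k r)"
proof -
  have "(\<Sum>r<p. g k r) = (\<Sum>t = k * p..<k * p + p. g (t div p) (t mod p))" for k
    by (rule sum.reindex_bij_witness[of _ "\<lambda>t. t - k * p" "\<lambda>r. r + k * p"])
       (auto simp: div_eq_dividend_iff intro!: arg_cong2[of _ _ _ _ g] split: nat_diff_split)
  then show ?thesis
    by (simp flip: sum.nat_group)
qed

section \<open>Coefficient identities of an isometric function\<close>

lemma infinite_unit_circle: "infinite unit_circle"
proof
  assume fin: "finite unit_circle"
  define N where "N = Suc (card unit_circle)"
  have "{z :: complex. z ^ N = 1} \<subseteq> unit_circle"
  proof
    fix z :: complex assume "z \<in> {z. z ^ N = 1}"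
    then have "cmod z ^ N = 1 ^ N" by (simp flip: norm_power)
    then have "cmod z = 1"
      by (rule power_eq_imp_eq_base) (auto simp: N_def)
    then show "z \<in> unit_circle" by (simp add: unit_circle_def)
  qed
  then have "card {z :: complex. z ^ N = 1} \<le> card unit_circle"
    by (rule card_mono[OF fin])
  moreover have "card {z :: complex. z ^ N = 1} = N"
    by (rule card_roots_unity_eq) (simp add: N_def)
  ultimately show False by (simp add: N_def)
qed

text \<open>
  Multiplication by \<open>z ^ n\<close> turns the Laurent identity into a polynomial one that holds at infinitely
  many points; the conclusion reads off its coefficients of degree \<open>n + d\<close>.
\<close>

lemma unit_circle_coeffs:
  fixes w :: "nat \<Rightarrow> nat \<Rightarrow> complex"
  assumes eq: "\<And>z. z \<in> unit_circle \<Longrightarrow> (\<Sum>k = 1..n. \<Sum>l = 1..n. w k l * z ^ k * inverse z ^ l) = e"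
    and zero: "\<And>k l. n < k \<Longrightarrow> w k l = 0"
  shows "(\<Sum>l = 1..n. w (l + d) l) = (if d = 0 then e else 0)"
proof -
  define P where "P = (\<Sum>k = 1..n. \<Sum>l = 1..n. monom (w k l) (n + k - l)) - monom e n"
  have "poly P z = 0" if z: "z \<in> unit_circle" for z
  proof -
    have z0: "z \<noteq> 0" using z by (auto simp: unit_circle_def)
    have *: "w k l * z ^ (n + k - l) = z ^ n * (w k l * z ^ k * inverse z ^ l)" if "l \<le> n" for k l
    proof -
      have "z ^ (n + k - l) * z ^ l = z ^ n * z ^ k"
        using that by (simp flip: power_add)
      then show ?thesis using z0 by (simp add: field_simps)
    qed
    have "poly P z = z ^ n * (\<Sum>k = 1..n. \<Sum>l = 1..n. w k l * z ^ k * inverse z ^ l) - e * z ^ n"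
      by (simp add: P_def poly_sum poly_monom sum_distrib_left * del: mult.assoc)
    then show ?thesis using eq[OF z] by simp
  qed
  then have "unit_circle \<subseteq> {z. poly P z = 0}" by auto
  then have "P = 0"
    using infinite_unit_circle poly_roots_finite finite_subset by blast
  have "(\<Sum>l = 1..n. w (l + d) l)
      = (\<Sum>l = 1..n. \<Sum>k = 1..n. if k = l + d then w k l else 0)"
    by (intro sum.cong) (auto simp: zero)
  also have "\<dots> = (\<Sum>k = 1..n. \<Sum>l = 1..n. if k = l + d then w k l else 0)"
    by (rule sum.swap)
  also have "\<dots> = (\<Sum>k = 1..n. \<Sum>l = 1..n. coeff (monom (w k l) (n + k - l)) (n + d))"
    by (intro sum.cong) auto
  also have "\<dots> = coeff (P + monom e n) (n + d)"
    by (simp add: P_def coeff_sum)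
  also have "\<dots> = (if d = 0 then e else 0)"
    using \<open>P = 0\<close> by simp
  finally show ?thesis .
qed

text \<open>Entries of the coefficients, with \<open>B\<^sub>k\<close> read as zero outside \<open>1 \<le> k \<le> n\<close>.\<close>

definition coeff_entry :: "nat \<Rightarrow> (nat \<Rightarrow> complex mat) \<Rightarrow> nat \<Rightarrow> nat \<Rightarrow> nat \<Rightarrow> complex" where
  "coeff_entry n B k r c = (if k \<in> {1..n} then B k $$ (r, c) else 0)"

lemma coeff_entry_0 [simp]: "coeff_entry n B 0 r c = 0"
  by (simp add: coeff_entry_def)

lemma coeff_entry_gt: "n < k \<Longrightarrow> coeff_entry n B k r c = 0"
  by (simp add: coeff_entry_def)

lemma isometry_coeffs:
  fixes B :: "nat \<Rightarrow> complex mat"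
  assumes iso: "\<And>z. z \<in> unit_circle \<Longrightarrow> mat_adjoint (F_o p m n B z) * F_o p m n B z = 1\<^sub>m m"
    and c: "c < m" "c' < m"
  shows "(\<Sum>l = 1..n. \<Sum>r<p. cnj (coeff_entry n B (l + d) r c) * coeff_entry n B l r c')
    = (if d = 0 \<and> c = c' then 1 else 0)"
proof -
  let ?b = "coeff_entry n B"
  have "(\<Sum>l = 1..n. \<Sum>r<p. cnj (?b (l + d) r c) * ?b l r c')
      = (if d = 0 then 1\<^sub>m m $$ (c, c') else 0)"
  proof (rule unit_circle_coeffs)
    fix z assume z: "z \<in> unit_circle"
    \<comment> \<open>Conjugation inverts \<open>z\<close> on the circle, so \<open>F\<^sub>o(z)\<^sup>*\<close> is a polynomial in \<open>z\<close>.\<close>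
    have cz: "cnj (inverse z) = z"
    proof -
      have "z * cnj z = 1" using z by (simp add: unit_circle_def complex_norm_square[symmetric])
      then show ?thesis by (metis complex_cnj_inverse inverse_unique mult.commute)
    qed
    have F: "F_o p m n B z $$ (r, j) = (\<Sum>l = 1..n. inverse z ^ l * ?b l r j)" if "r < p" "j < m" for r j
      using that by (simp add: F_o_def coeff_entry_def)
    have Fc: "F_o p m n B z \<in> carrier_mat p m" by (simp add: F_o_def)
    have "1\<^sub>m m $$ (c, c') = (\<Sum>r<p. cnj (F_o p m n B z $$ (r, c)) * F_o p m n B z $$ (r, c'))"
      unfolding iso[OF z, symmetric] by (rule index_adjoint_mult[OF Fc Fc c])
    also have "\<dots> = (\<Sum>r<p. (\<Sum>k = 1..n. z ^ k * cnj (?b k r c)) * (\<Sum>l = 1..n. inverse z ^ l * ?b l r c'))"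
      using c by (intro sum.cong) (simp_all add: F cz del: complex_cnj_inverse)
    also have "\<dots> = (\<Sum>r<p. \<Sum>k = 1..n. \<Sum>l = 1..n. cnj (?b k r c) * ?b l r c' * z ^ k * inverse z ^ l)"
      by (simp add: sum_product mult_ac)
    also have "\<dots> = (\<Sum>k = 1..n. \<Sum>r<p. \<Sum>l = 1..n. cnj (?b k r c) * ?b l r c' * z ^ k * inverse z ^ l)"
      by (rule sum.swap)
    also have "\<dots> = (\<Sum>k = 1..n. \<Sum>l = 1..n. \<Sum>r<p. cnj (?b k r c) * ?b l r c' * z ^ k * inverse z ^ l)"
      by (intro sum.cong refl sum.swap)
    finally show "(\<Sum>k = 1..n. \<Sum>l = 1..n. (\<Sum>r<p. cnj (?b k r c) * ?b l r c') * z ^ k * inverse z ^ l)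
        = 1\<^sub>m m $$ (c, c')"
      by (simp add: sum_distrib_right)
  qed (simp add: coeff_entry_gt)
  then show ?thesis using c by simp
qed

lemma F_o_adjoint:
  assumes "\<And>k. k \<in> {1..n} \<Longrightarrow> B k \<in> carrier_mat p m"
  shows "F_o m p n (\<lambda>k. mat_adjoint (B k)) z = mat_adjoint (F_o p m n B (cnj z))"
proof (rule eq_matI)
  fix i j
  assume "i < dim_row (mat_adjoint (F_o p m n B (cnj z)))" "j < dim_col (mat_adjoint (F_o p m n B (cnj z)))"
  then have ij: "i < m" "j < p" by (simp_all add: F_o_def)
  have "mat_adjoint (B k) $$ (i, j) = cnj (B k $$ (j, i))" if "k \<in> {1..n}" for k
    using assms[OF that] ij by (intro index_mat_adjoint) auto
  then show "F_o m p n (\<lambda>k. mat_adjoint (B k)) z $$ (i, j) = mat_adjoint (F_o p m n B (cnj z)) $$ (i, j)"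
    using ij by (simp add: F_o_def)
qed (simp_all add: F_o_def)

lemma isometry_adjoint:
  assumes "\<And>k. k \<in> {1..n} \<Longrightarrow> B k \<in> carrier_mat p m"
    and "\<And>z. z \<in> unit_circle \<Longrightarrow> F_o p m n B z * mat_adjoint (F_o p m n B z) = 1\<^sub>m p"
    and "z \<in> unit_circle"
  shows "mat_adjoint (F_o m p n (\<lambda>k. mat_adjoint (B k)) z) * F_o m p n (\<lambda>k. mat_adjoint (B k)) z = 1\<^sub>m p"
proof -
  have "F_o m p n (\<lambda>k. mat_adjoint (B k)) z = mat_adjoint (F_o p m n B (cnj z))"
    by (rule F_o_adjoint) (rule assms(1))
  then show ?thesis
    using assms(2)[of "cnj z"] assms(3) by (simp add: unit_circle_def)
qed

lemma coisometry_coeffs: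
  fixes B :: "nat \<Rightarrow> complex mat"
  assumes B: "\<And>k. k \<in> {1..n} \<Longrightarrow> B k \<in> carrier_mat p m"
    and coiso: "\<And>z. z \<in> unit_circle \<Longrightarrow> F_o p m n B z * mat_adjoint (F_o p m n B z) = 1\<^sub>m p"
    and r: "r < p" "r' < p"
  shows "(\<Sum>l = 1..n. \<Sum>c<m. coeff_entry n B (l + d) r c * cnj (coeff_entry n B l r' c))
    = (if d = 0 \<and> r = r' then 1 else 0)"
proof -
  have "coeff_entry n (\<lambda>k. mat_adjoint (B k)) k c r = cnj (coeff_entry n B k r c)" if "c < m" "r < p" for k c r
    using B[of k] that by (cases "k \<in> {1..n}") (auto simp: coeff_entry_def)
  then show ?thesis
    using isometry_coeffs[OF isometry_adjoint[OF B coiso] r, of d] r by simp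
qed

section \<open>The defect of the Hankel matrix\<close>

text \<open>
  The blocks \<open>(i, j)\<close>, counted from zero, of \<open>H\<^sub>0\<^sup>* H\<^sub>0 + K\<^sup>* K = I\<close>. In the second sum the subtraction
  of natural numbers is truncated, and the truncated terms vanish because the zeroth coefficient is zero.
\<close>

lemma hankel_defect_entry:
  fixes B :: "nat \<Rightarrow> complex mat"
  assumes iso: "\<And>z. z \<in> unit_circle \<Longrightarrow> mat_adjoint (F_o p m n B z) * F_o p m n B z = 1\<^sub>m m"
    and c: "c < m" "c' < m" and ij: "i < n" "j < n"
  shows "(\<Sum>k<n. \<Sum>r<p. cnj (coeff_entry n B (k + i + 1) r c) * coeff_entry n B (k + j + 1) r c')
       + (\<Sum>k<n. \<Sum>r<p. cnj (coeff_entry n B (i - k) r c) * coeff_entry n B (j - k) r c')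
    = (if i = j \<and> c = c' then 1 else 0)"
proof -
  let ?b = "coeff_entry n B"
  have *: "(\<Sum>k<n. g (k + i + 1) (k + j + 1)) + (\<Sum>k<n. g (i - k) (j - k)) = (\<Sum>l = 1..n. g (l + (i - j)) l)"
    if ji: "j \<le> i" and i: "i < n" and g: "\<And>k l. k = 0 \<or> l = 0 \<or> n < k \<or> n < l \<Longrightarrow> g k l = 0"
    for i j and g :: "nat \<Rightarrow> nat \<Rightarrow> complex"
  proof -
    \<comment> \<open>With \<open>l\<close> the index into column \<open>j\<close>, the first sum covers \<open>l > j\<close> and the second covers \<open>1 \<le> l \<le> j\<close>.\<close>
    define h where "h l = g (l + (i - j)) l" for l
    have "(\<Sum>k<n. g (k + i + 1) (k + j + 1)) = (\<Sum>l\<in>{j+1..j+n}. h l)"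
      by (rule sum.reindex_bij_witness[of _ "\<lambda>l. l - (j + 1)" "\<lambda>k. k + j + 1"])
         (use ji in \<open>auto simp: h_def\<close>)
    moreover have "(\<Sum>k<n. g (i - k) (j - k)) = (\<Sum>k<j. g (i - k) (j - k))"
      by (rule sum.mono_neutral_right) (use ji i in \<open>auto simp: g\<close>)
    moreover have "(\<Sum>k<j. g (i - k) (j - k)) = (\<Sum>l\<in>{1..j}. h l)"
      by (rule sum.reindex_bij_witness[of _ "\<lambda>l. j - l" "\<lambda>k. j - k"])
         (use ji in \<open>auto simp: h_def\<close>)
    moreover have "(\<Sum>l\<in>{j+1..j+n}. h l) + (\<Sum>l\<in>{1..j}. h l) = (\<Sum>l\<in>{j+1..j+n} \<union> {1..j}. h l)"
      by (rule sum.union_disjoint[symmetric]) auto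
    moreover have "(\<Sum>l\<in>{j+1..j+n} \<union> {1..j}. h l) = (\<Sum>l = 1..n. h l)"
      by (rule sum.mono_neutral_right) (use ji i in \<open>auto simp: h_def g\<close>)
    ultimately show ?thesis by (simp add: h_def)
  qed
  show ?thesis
  proof (cases "j \<le> i")
    case True
    have "(\<Sum>k<n. \<Sum>r<p. cnj (?b (k + i + 1) r c) * ?b (k + j + 1) r c')
        + (\<Sum>k<n. \<Sum>r<p. cnj (?b (i - k) r c) * ?b (j - k) r c')
      = (\<Sum>l = 1..n. \<Sum>r<p. cnj (?b (l + (i - j)) r c) * ?b l r c')"
      by (rule *[OF True ij(1)]) (auto simp: coeff_entry_gt)
    also have "\<dots> = (if i = j \<and> c = c' then 1 else 0)"
      using True by (simp only: isometry_coeffs[OF iso c]) auto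
    finally show ?thesis .
  next
    case False
    then have "i \<le> j" by simp
    have "(\<Sum>k<n. \<Sum>r<p. cnj (?b (k + i + 1) r c) * ?b (k + j + 1) r c')
        + (\<Sum>k<n. \<Sum>r<p. cnj (?b (i - k) r c) * ?b (j - k) r c')
      = (\<Sum>l = 1..n. \<Sum>r<p. cnj (?b l r c) * ?b (l + (j - i)) r c')"
      by (rule *[OF \<open>i \<le> j\<close> ij(2)]) (auto simp: coeff_entry_gt)
    also have "\<dots> = cnj (\<Sum>l = 1..n. \<Sum>r<p. cnj (?b (l + (j - i)) r c') * ?b l r c)"
      by (simp add: mult.commute)
    also have "\<dots> = 0"
      using False by (simp only: isometry_coeffs[OF iso c(2,1)]) auto
    finally show ?thesis using False by auto
  qed
qed

text \<open>
  The matrix \<open>K\<close> of the rows above the Hankel matrix, without its first block column, which is zero.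
  With blocks counted from zero, block \<open>(k, j)\<close> of \<open>K\<close> is \<open>B\<^sub>j\<^sub>-\<^sub>k\<close>, and \<open>j = t div m + 1\<close> accounts for the
  deleted block column. The subtraction is truncated, so that all blocks on and below the diagonal
  of \<open>K\<close> are read as the zeroth coefficient, which is zero.
\<close>

definition upper_rows :: "nat \<Rightarrow> nat \<Rightarrow> nat \<Rightarrow> (nat \<Rightarrow> complex mat) \<Rightarrow> complex mat" where
  "upper_rows p m n B = mat (n * p) (m * n - m)
     (\<lambda>(s, t). coeff_entry n B (t div m + 1 - s div p) (s mod p) (t mod m))"

text \<open>The Hankel matrix without its first block column.\<close>

definition hankel_tail :: "nat \<Rightarrow> nat \<Rightarrow> nat \<Rightarrow> (nat \<Rightarrow> complex mat) \<Rightarrow> complex mat" where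
  "hankel_tail p m n B = mat (n * p) (m * n - m)
     (\<lambda>(s, t). coeff_entry n B (s div p + t div m + 2) (s mod p) (t mod m))"

lemma hankel_H0_entry:
  assumes "s < n * p" "t < m * n"
  shows "hankel_H0 p m n B $$ (s, t) = coeff_entry n B (s div p + t div m + 1) (s mod p) (t mod m)"
  using assms by (simp add: hankel_H0_def coeff_entry_def Let_def mult.commute)

lemma hankel_defect:
  fixes B :: "nat \<Rightarrow> complex mat"
  assumes iso: "\<And>z. z \<in> unit_circle \<Longrightarrow> mat_adjoint (F_o p m n B z) * F_o p m n B z = 1\<^sub>m m"
    and t: "t < m * n" "t' < m * n"
  shows "(1\<^sub>m (m * n) - mat_adjoint (hankel_H0 p m n B) * hankel_H0 p m n B) $$ (t, t')
    = (\<Sum>k<n. \<Sum>r<p. cnj (coeff_entry n B (t div m - k) r (t mod m)) * coeff_entry n B (t' div m - k) r (t' mod m))"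
proof -
  let ?b = "coeff_entry n B" and ?H = "hankel_H0 p m n B"
  have H: "?H \<in> carrier_mat (n * p) (m * n)" by (simp add: hankel_H0_def mult.commute)
  have m: "0 < m" using t by (cases m) auto
  have "(mat_adjoint ?H * ?H) $$ (t, t') = (\<Sum>s<n * p. cnj (?b (s div p + t div m + 1) (s mod p) (t mod m))
        * ?b (s div p + t' div m + 1) (s mod p) (t' mod m))"
    unfolding index_adjoint_mult[OF H H t] using t by (intro sum.cong) (simp_all add: hankel_H0_entry)
  also have "\<dots> = (\<Sum>k<n. \<Sum>r<p. cnj (?b (k + t div m + 1) r (t mod m)) * ?b (k + t' div m + 1) r (t' mod m))"
    by (rule sum_blocks)
  finally have HH: "(mat_adjoint ?H * ?H) $$ (t, t') = \<dots>" .
  have "t = t' \<longleftrightarrow> t div m = t' div m \<and> t mod m = t' mod m"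
    by (metis div_mult_mod_eq)
  moreover have "t div m < n" "t' div m < n"
    using t by (simp_all add: less_mult_imp_div_less mult.commute)
  ultimately have "(\<Sum>k<n. \<Sum>r<p. cnj (?b (k + t div m + 1) r (t mod m)) * ?b (k + t' div m + 1) r (t' mod m))
      + (\<Sum>k<n. \<Sum>r<p. cnj (?b (t div m - k) r (t mod m)) * ?b (t' div m - k) r (t' mod m))
    = 1\<^sub>m (m * n) $$ (t, t')"
    using hankel_defect_entry[OF iso, of "t mod m" "t' mod m" "t div m" "t' div m"] m t by simp
  moreover have "(1\<^sub>m (m * n) - mat_adjoint ?H * ?H) $$ (t, t')
      = 1\<^sub>m (m * n) $$ (t, t') - (mat_adjoint ?H * ?H) $$ (t, t')"
    using t H by (intro index_minus_mat) auto
  moreover have "x = b" if "a + b = e" "x = e - h" "h = a" for a b e h x :: complex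
    using that by auto
  ultimately show ?thesis
    using HH by blast
qed

lemma upper_rows_gram_entry:
  assumes "t < m * n - m" "t' < m * n - m"
  shows "(mat_adjoint (upper_rows p m n B) * upper_rows p m n B) $$ (t, t')
    = (\<Sum>k<n. \<Sum>r<p. cnj (coeff_entry n B (t div m + 1 - k) r (t mod m))
        * coeff_entry n B (t' div m + 1 - k) r (t' mod m))"
proof -
  have K: "upper_rows p m n B \<in> carrier_mat (n * p) (m * n - m)" by (simp add: upper_rows_def)
  show ?thesis
    unfolding index_adjoint_mult[OF K K assms] sum_blocks[symmetric]
    using assms by (intro sum.cong) (simp_all add: upper_rows_def)
qed

lemma hankel_tail_gram_entry:
  assumes "t < m * n - m" "t' < m * n - m"
  shows "(mat_adjoint (hankel_tail p m n B) * hankel_tail p m n B) $$ (t, t')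
    = (\<Sum>k<n. \<Sum>r<p. cnj (coeff_entry n B (k + t div m + 2) r (t mod m))
        * coeff_entry n B (k + t' div m + 2) r (t' mod m))"
proof -
  have H: "hankel_tail p m n B \<in> carrier_mat (n * p) (m * n - m)" by (simp add: hankel_tail_def)
  show ?thesis
    unfolding index_adjoint_mult[OF H H assms] sum_blocks[symmetric]
    using assms by (intro sum.cong) (simp_all add: hankel_tail_def)
qed

lemma one_minus_upper_rows_gram:
  fixes B :: "nat \<Rightarrow> complex mat"
  assumes iso: "\<And>z. z \<in> unit_circle \<Longrightarrow> mat_adjoint (F_o p m n B z) * F_o p m n B z = 1\<^sub>m m"
  shows "1\<^sub>m (m * n - m) - mat_adjoint (upper_rows p m n B) * upper_rows p m n B
    = mat_adjoint (hankel_tail p m n B) * hankel_tail p m n B" (is "?L = ?R")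
proof (rule eq_matI)
  let ?b = "coeff_entry n B"
  fix t t' assume "t < dim_row ?R" "t' < dim_col ?R"
  then have t: "t < m * n - m" "t' < m * n - m" by (simp_all add: hankel_tail_def)
  have m: "0 < m" using t by (cases m) auto
  have "m * n - m = (n - 1) * m"
    by (simp add: algebra_simps)
  then have div: "t div m + 1 < n" "t' div m + 1 < n"
    using t less_mult_imp_div_less[of t "n - 1" m] less_mult_imp_div_less[of t' "n - 1" m] by auto
  have "t = t' \<longleftrightarrow> t div m = t' div m \<and> t mod m = t' mod m"
    by (metis div_mult_mod_eq)
  then have "?R $$ (t, t') + (mat_adjoint (upper_rows p m n B) * upper_rows p m n B) $$ (t, t')
      = 1\<^sub>m (m * n - m) $$ (t, t')"
    using hankel_defect_entry[OF iso, of "t mod m" "t' mod m" "t div m + 1" "t' div m + 1"] m t div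
    by (simp add: upper_rows_gram_entry hankel_tail_gram_entry del: index_mult_mat(1))
  moreover have "?L $$ (t, t') = 1\<^sub>m (m * n - m) $$ (t, t')
      - (mat_adjoint (upper_rows p m n B) * upper_rows p m n B) $$ (t, t')"
    using t by (intro index_minus_mat) (auto simp: upper_rows_def)
  ultimately show "?L $$ (t, t') = ?R $$ (t, t')"
    by (metis add_diff_cancel_right')
qed (auto simp: upper_rows_def hankel_tail_def)

text \<open>
  Block \<open>(k, k')\<close> of the product, counted from zero, is the coefficient of \<open>F\<^sub>o(z) F\<^sub>o(z)\<^sup>*\<close> belonging to the
  shift \<open>k + k' + 1\<close>: no term of that coefficient is lost by restricting to the columns present.
\<close>

lemma upper_rows_hankel_tail_orthogonal:
  fixes B :: "nat \<Rightarrow> complex mat"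
  assumes B: "\<And>k. k \<in> {1..n} \<Longrightarrow> B k \<in> carrier_mat p m"
    and coiso: "\<And>z. z \<in> unit_circle \<Longrightarrow> F_o p m n B z * mat_adjoint (F_o p m n B z) = 1\<^sub>m p"
  shows "upper_rows p m n B * mat_adjoint (hankel_tail p m n B) = 0\<^sub>m (n * p) (n * p)"
proof (rule eq_matI)
  let ?b = "coeff_entry n B"
  fix s s' assume "s < dim_row (0\<^sub>m (n * p) (n * p) :: complex mat)" "s' < dim_col (0\<^sub>m (n * p) (n * p) :: complex mat)"
  then have s: "s < n * p" "s' < n * p" by simp_all
  have K: "upper_rows p m n B \<in> carrier_mat (n * p) (m * n - m)" by (simp add: upper_rows_def)
  have H: "hankel_tail p m n B \<in> carrier_mat (n * p) (m * n - m)" by (simp add: hankel_tail_def)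
  have p: "0 < p" using s by (cases p) auto
  define k k' r r' where "k = s div p" and "k' = s' div p" and "r = s mod p" and "r' = s' mod p"
  have r: "r < p" "r' < p" using p by (simp_all add: r_def r'_def)
  have blocks: "m * n - m = (n - 1) * m"
    by (simp add: algebra_simps)
  define h where "h l = (\<Sum>c<m. ?b l r c * cnj (?b (l + (k + k' + 1)) r' c))" for l
  have "(upper_rows p m n B * mat_adjoint (hankel_tail p m n B)) $$ (s, s')
      = (\<Sum>t<(n - 1) * m. ?b (t div m + 1 - k) r (t mod m) * cnj (?b (k' + t div m + 2) r' (t mod m)))"
    unfolding index_mult_adjoint[OF K H s] blocks
    using s by (intro sum.cong) (simp_all add: upper_rows_def hankel_tail_def k_def k'_def r_def r'_def blocks)
  also have "\<dots> = (\<Sum>j<n - 1. \<Sum>c<m. ?b (j + 1 - k) r c * cnj (?b (k' + j + 2) r' c))"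
    by (rule sum_blocks)
  also have "\<dots> = (\<Sum>j\<in>{k..<n - 1}. \<Sum>c<m. ?b (j + 1 - k) r c * cnj (?b (k' + j + 2) r' c))"
    by (rule sum.mono_neutral_right) auto
  also have "\<dots> = (\<Sum>l\<in>{1..<n - k}. h l)"
    by (rule sum.reindex_bij_witness[of _ "\<lambda>l. l + k - 1" "\<lambda>j. j + 1 - k"])
       (auto simp: h_def add_ac)
  also have "\<dots> = (\<Sum>l = 1..n. h l)"
    by (rule sum.mono_neutral_left) (auto simp: h_def coeff_entry_gt)
  also have "\<dots> = cnj (\<Sum>l = 1..n. \<Sum>c<m. ?b (l + (k + k' + 1)) r' c * cnj (?b l r c))"
    by (simp add: h_def mult.commute)
  also have "\<dots> = 0"
    by (simp only: coisometry_coeffs[OF B coiso r(2,1)]) simp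
  finally show "(upper_rows p m n B * mat_adjoint (hankel_tail p m n B)) $$ (s, s')
      = 0\<^sub>m (n * p) (n * p) $$ (s, s')"
    using s by simp
qed (simp_all add: upper_rows_def hankel_tail_def)

lemma hankel_isometric_case:
  fixes B :: "nat \<Rightarrow> complex mat"
  assumes n: "0 < n"
    and B: "\<And>k. k \<in> {1..n} \<Longrightarrow> B k \<in> carrier_mat p m"
    and iso: "\<And>z. z \<in> unit_circle \<Longrightarrow> mat_adjoint (F_o p m n B z) * F_o p m n B z = 1\<^sub>m m"
    and coiso: "\<And>z. p = m \<Longrightarrow> z \<in> unit_circle \<Longrightarrow> F_o p m n B z * mat_adjoint (F_o p m n B z) = 1\<^sub>m p"
  shows "\<exists>\<Delta> \<in> carrier_mat (m * n - m) (m * n - m).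
         1\<^sub>m (m * n) - mat_adjoint (hankel_H0 p m n B) * hankel_H0 p m n B =
           four_block_mat (0\<^sub>m m m) (0\<^sub>m m (m * n - m)) (0\<^sub>m (m * n - m) m) \<Delta> \<and>
         psd_weak_contraction \<Delta> \<and>
         (p = m \<longrightarrow> orthogonal_projection \<Delta>)"
proof -
  define K where "K = upper_rows p m n B"
  define H where "H = hankel_tail p m n B"
  define \<Delta> where "\<Delta> = mat_adjoint K * K"
  have K: "K \<in> carrier_mat (n * p) (m * n - m)" by (simp add: K_def upper_rows_def)
  have H: "H \<in> carrier_mat (n * p) (m * n - m)" by (simp add: H_def hankel_tail_def)
  have D: "\<Delta> \<in> carrier_mat (m * n - m) (m * n - m)" using K by (auto simp: \<Delta>_def)
  have comp: "1\<^sub>m (m * n - m) - \<Delta> = mat_adjoint H * H"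
    unfolding \<Delta>_def K_def H_def by (rule one_minus_upper_rows_gram[OF iso])
  have mn: "m \<le> m * n" using n by simp
  have block: "1\<^sub>m (m * n) - mat_adjoint (hankel_H0 p m n B) * hankel_H0 p m n B =
           four_block_mat (0\<^sub>m m m) (0\<^sub>m m (m * n - m)) (0\<^sub>m (m * n - m) m) \<Delta>" (is "?L = ?R")
  proof (rule eq_matI)
    fix t t' assume "t < dim_row ?R" "t' < dim_col ?R"
    then have t: "t < m * n" "t' < m * n" using D mn by auto
    have L: "?L $$ (t, t') = (\<Sum>k<n. \<Sum>r<p. cnj (coeff_entry n B (t div m - k) r (t mod m))
        * coeff_entry n B (t' div m - k) r (t' mod m))"
      by (rule hankel_defect[OF iso t])
    show "?L $$ (t, t') = ?R $$ (t, t')"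
    proof (cases "t < m \<or> t' < m")
      case True
      then show ?thesis unfolding L using t D mn by auto
    next
      case False
      then obtain u u' where u: "t = u + m" "t' = u' + m" "u < m * n - m" "u' < m * n - m"
        using t by (metis add.commute le_Suc_ex less_diff_conv not_less)
      have m: "0 < m" using t by (cases m) auto
      have "?R $$ (t, t') = \<Delta> $$ (u, u')"
        using u D mn t by auto
      also have "\<dots> = ?L $$ (t, t')"
        unfolding L \<Delta>_def K_def upper_rows_gram_entry[OF u(3,4)] using m by (simp add: u)
      finally show ?thesis ..
    qed
  qed (use D mn in \<open>auto simp: hankel_H0_def mult.commute\<close>)
  have psd: "psd_weak_contraction \<Delta>"
    unfolding psd_weak_contraction_def using comp D psd_gram[of K] psd_gram[of H] by (auto simp: \<Delta>_def)
  have "orthogonal_projection \<Delta>" if "p = m"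
  proof -
    have KH: "K * mat_adjoint H = 0\<^sub>m (n * p) (n * p)"
      unfolding K_def H_def by (rule upper_rows_hankel_tail_orthogonal[OF B coiso[OF that]])
    have K': "mat_adjoint K \<in> carrier_mat (m * n - m) (n * p)"
      and H': "mat_adjoint H \<in> carrier_mat (m * n - m) (n * p)"
      using K H by simp_all
    have "\<Delta> - \<Delta> * \<Delta> = \<Delta> * (1\<^sub>m (m * n - m) - \<Delta>)"
      using D by (simp add: mult_minus_distrib_mat[OF D one_carrier_mat D])
    also have "\<dots> = mat_adjoint K * K * (mat_adjoint H * H)"
      unfolding comp by (simp add: \<Delta>_def)
    also have "\<dots> = mat_adjoint K * (K * (mat_adjoint H * H))"
      by (rule assoc_mult_mat[OF K' K mult_carrier_mat[OF H' H]])
    also have "K * (mat_adjoint H * H) = K * mat_adjoint H * H"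
      by (rule assoc_mult_mat[OF K H' H, symmetric])
    also have "mat_adjoint K * (K * mat_adjoint H * H) = 0\<^sub>m (m * n - m) (m * n - m)"
      unfolding KH left_mult_zero_mat[OF H] by (rule right_mult_zero_mat[OF K'])
    finally have zero: "\<Delta> - \<Delta> * \<Delta> = 0\<^sub>m (m * n - m) (m * n - m)" .
    have "\<Delta> = \<Delta> * \<Delta>"
    proof (rule eq_matI)
      fix i j assume "i < dim_row (\<Delta> * \<Delta>)" "j < dim_col (\<Delta> * \<Delta>)"
      then have ij: "i < m * n - m" "j < m * n - m" using D by auto
      have "(\<Delta> - \<Delta> * \<Delta>) $$ (i, j) = \<Delta> $$ (i, j) - (\<Delta> * \<Delta>) $$ (i, j)"
        using ij D by (intro index_minus_mat) auto
      then show "\<Delta> $$ (i, j) = (\<Delta> * \<Delta>) $$ (i, j)"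
        unfolding zero using ij by simp
    qed (use D in auto)
    then show ?thesis
      using hermitian_gram[of K] by (simp add: orthogonal_projection_def hermitian_mat_def \<Delta>_def)
  qed
  then show ?thesis using D block psd by blast
qed

lemma hankel_H0_adjoint:
  assumes p: "0 < p" and m: "0 < m" and B: "\<And>k. k \<in> {1..n} \<Longrightarrow> B k \<in> carrier_mat p m"
  shows "hankel_H0 m p n (\<lambda>k. mat_adjoint (B k)) = mat_adjoint (hankel_H0 p m n B)"
proof (rule eq_matI)
  fix i j
  assume "i < dim_row (mat_adjoint (hankel_H0 p m n B))" "j < dim_col (mat_adjoint (hankel_H0 p m n B))"
  then have ij: "i < n * m" "j < n * p" by (simp_all add: hankel_H0_def)
  have "mat_adjoint (B k) $$ (i mod m, j mod p) = cnj (B k $$ (j mod p, i mod m))" if "k \<in> {1..n}" for k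
    using B[OF that] p m by (intro index_mat_adjoint) auto
  then show "hankel_H0 m p n (\<lambda>k. mat_adjoint (B k)) $$ (i, j) = mat_adjoint (hankel_H0 p m n B) $$ (i, j)"
    using ij by (simp add: hankel_H0_def Let_def add.commute)
qed (simp_all add: hankel_H0_def)

theorem proposition4p2:
  fixes p m n :: nat and B :: "nat \<Rightarrow> complex mat"
  assumes "0 < p" and "0 < m" and "0 < n"
    and "\<And>k. k \<in> {1..n} \<Longrightarrow> B k \<in> carrier_mat p m"
    and "class_U p m (F_o p m n B)"
  shows "(m \<le> p \<longrightarrow>
      (\<exists>\<Delta> \<in> carrier_mat (m * n - m) (m * n - m).
         1\<^sub>m (m * n) - mat_adjoint (hankel_H0 p m n B) * hankel_H0 p m n B =
           four_block_mat (0\<^sub>m m m) (0\<^sub>m m (m * n - m)) (0\<^sub>m (m * n - m) m) \<Delta> \<and>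
         psd_weak_contraction \<Delta> \<and>
         (p = m \<longrightarrow> orthogonal_projection \<Delta>))) \<and>
    (p \<le> m \<longrightarrow>
      (\<exists>\<Delta> \<in> carrier_mat (p * n - p) (p * n - p).
         1\<^sub>m (p * n) - hankel_H0 p m n B * mat_adjoint (hankel_H0 p m n B) =
           four_block_mat (0\<^sub>m p p) (0\<^sub>m p (p * n - p)) (0\<^sub>m (p * n - p) p) \<Delta> \<and>
         psd_weak_contraction \<Delta> \<and>
         (p = m \<longrightarrow> orthogonal_projection \<Delta>)))"
proof (intro conjI impI)
  assume "m \<le> p"
  then show "\<exists>\<Delta> \<in> carrier_mat (m * n - m) (m * n - m).
         1\<^sub>m (m * n) - mat_adjoint (hankel_H0 p m n B) * hankel_H0 p m n B =
           four_block_mat (0\<^sub>m m m) (0\<^sub>m m (m * n - m)) (0\<^sub>m (m * n - m) m) \<Delta> \<and>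
         psd_weak_contraction \<Delta> \<and>
         (p = m \<longrightarrow> orthogonal_projection \<Delta>)"
    using assms(5) by (intro hankel_isometric_case assms(3,4)) (auto simp: class_U_def)
next
  assume "p \<le> m"
  let ?B = "\<lambda>k. mat_adjoint (B k)"
  have coiso: "F_o p m n B z * mat_adjoint (F_o p m n B z) = 1\<^sub>m p" if "z \<in> unit_circle" for z
    using assms(5) \<open>p \<le> m\<close> that by (simp add: class_U_def)
  have "F_o m p n ?B z * mat_adjoint (F_o m p n ?B z) = 1\<^sub>m m" if "m = p" "z \<in> unit_circle" for z
  proof -
    have "F_o m p n ?B z = mat_adjoint (F_o p m n B (cnj z))"
      by (rule F_o_adjoint) (rule assms(4))
    then show ?thesis
      using assms(5) that by (simp add: class_U_def unit_circle_def)
  qed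
  then have "\<exists>\<Delta> \<in> carrier_mat (p * n - p) (p * n - p).
         1\<^sub>m (p * n) - mat_adjoint (hankel_H0 m p n ?B) * hankel_H0 m p n ?B =
           four_block_mat (0\<^sub>m p p) (0\<^sub>m p (p * n - p)) (0\<^sub>m (p * n - p) p) \<Delta> \<and>
         psd_weak_contraction \<Delta> \<and>
         (m = p \<longrightarrow> orthogonal_projection \<Delta>)"
    using assms(4) by (intro hankel_isometric_case[OF assms(3)] isometry_adjoint coiso) auto
  moreover have "hankel_H0 m p n ?B = mat_adjoint (hankel_H0 p m n B)"
    by (rule hankel_H0_adjoint) (rule assms; assumption?)+
  ultimately show "\<exists>\<Delta> \<in> carrier_mat (p * n - p) (p * n - p).
         1\<^sub>m (p * n) - hankel_H0 p m n B * mat_adjoint (hankel_H0 p m n B) =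
           four_block_mat (0\<^sub>m p p) (0\<^sub>m p (p * n - p)) (0\<^sub>m (p * n - p) p) \<Delta> \<and>
         psd_weak_contraction \<Delta> \<and>
         (p = m \<longrightarrow> orthogonal_projection \<Delta>)"
    by (simp only: mat_adjoint_adjoint eq_commute[of m p])
qed

end
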